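(* Let $m\ge1$ be an integer and $n=2m$. Let $C_1\subseteq\mathbb{F}_2^n$ be a binary linear code of length $n$ and $C_2\subseteq\mathbb{F}_3^n$ a ternary linear code of length $n$, and define $$C=a\,C_1\oplus b\,C_2=\{a\mathbf{u}+b\mathbf{v}:\mathbf{u}\in C_1,\ \mathbf{v}\in C_2\}\subseteq H_{23}^n.$$ If $C_1$ is a binary symplectic self-orthogonal code, then $C$ is a symplectic self-orthogonal $H_{23}$-code of length $n$ with $C_a=C_1$ and $C_b=C_2$. Moreover, if in addition $|C_1|\,|C_2|=6^m$, then $C$ is symplectic quasi self-dual (symplectic-QSD).
   Context: Ring: $H_{23}=\langle a,b\mid 2a=0,\ 3b=0,\ a^2=a,\ b^2=0,\ ab=ba=0\rangle$ is the commutative non-unital ring of order six with elements $0,a,b,a+b,2b,a+2b$. For $\mathbf{x}\in\mathbb{F}_2^n$, $a\mathbf{x}$ is the vector obtained coordinatewise from $a\cdot0=0$, $a\cdot1=a$; for $\mathbf{y}\in\mathbb{F}_3^n$, $b\mathbf{y}$ is obtained coordinatewise from $b\cdot0=0$, $b\cdot1=b$, $b\cdot2=2b$. Every vector of $H_{23}^n$ is uniquely $a\mathbf{x}+b\mathbf{y}$ with $\mathbf{x}\in\mathbb{F}_2^n$, $\mathbf{y}\in\mathbb{F}_3^n$. Codes: an $H_{23}$-code of length $n$ is an $H_{23}$-submodule $C\subseteq H_{23}^n$ (an additive subgroup closed under multiplication by elements of $H_{23}$). Any such code decomposes as $C=aC_a\oplus bC_b$ with binary component $C_a=\{\mathbf{u}\in\mathbb{F}_2^n: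 a\mathbf{u}\in C\}$ and ternary component $C_b=\{\mathbf{v}\in\mathbb{F}_3^n: b\mathbf{v}\in C\}$, which are linear codes over $\mathbb{F}_2$ and $\mathbb{F}_3$ respectively. Symplectic forms: for $\mathbf{x}=(\mathbf{x}_1\mid\mathbf{x}_2),\mathbf{y}=(\mathbf{y}_1\mid\mathbf{y}_2)\in\mathbb{F}_2^{2m}$ with $\mathbf{x}_i,\mathbf{y}_i\in\mathbb{F}_2^m$, set $\langle\mathbf{x},\mathbf{y}\rangle_s^{(\mathbb{F}_2)}=\mathbf{x}_1\cdot\mathbf{y}_2+\mathbf{x}_2\cdot\mathbf{y}_1$, where $\cdot$ is the usual dot product. For $\mathbf{c}=a\mathbf{x}+b\mathbf{y}$, $\mathbf{c}'=a\mathbf{x}'+b\mathbf{y}'$ in $H_{23}^{2m}$ (with $\mathbf{x},\mathbf{x}'\in\mathbb{F}_2^{2m}$, $\mathbf{y},\mathbf{y}'\in\mathbb{F}_3^{2m}$), set $\langle\mathbf{c},\mathbf{c}'\rangle_S=a\langle\mathbf{x},\mathbf{x}'\rangle_s^{(\mathbb{F}_2)}$ (the ternary part contributes $0$ because $b^2=0$). The symplectic dual $C^{\perp_S}$ of a code $C$ (over $\mathbb{F}_2$ or $H_{23}$, of length $2m$) is the set of all vectors of the ambient space orthogonal to every element of $C$ under the corresponding symplectic form. $C$ is symplectic self-orthogonal if $C\subseteq C^{\perp_S}$. An $H_{23}$-code of length $2m$ is symplectic quasi self-dual (symplectic-QSD) if it is symplectic self-orthogonal and has exactly $6^m$ elements.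 *)

theory Defs
  imports "HOL-Analysis.Analysis" "HOL-Library.Numeral_Type"
begin

section \<open>The prime fields and linear codes\<close>

text \<open>
  The numeral types \<open>2\<close> and \<open>3\<close> carry arithmetic modulo 2 and 3. The library makes them
  commutative rings with one only, so the field property is recorded as a lemma below.
\<close>

type_synonym F2 = 2
type_synonym F3 = 3

lemma F2_cases: "x = 0 \<or> x = 1" for x :: F2
proof (cases x)
  case (of_int z)
  then have "z = 0 \<or> z = 1" by auto
  then show ?thesis using of_int by auto
qed

lemma F3_cases: "x = 0 \<or> x = 1 \<or> x = 2" for x :: F3
proof (cases x)
  case (of_int z)
  then have "z = 0 \<or> z = 1 \<or> z = 2" by auto
  then show ?thesis using of_int by auto
qed

lemma F2_arith: "(1::F2) + 1 = 0" and F3_arith: "(1::F3) + 2 = 0" "(2::F3) * 2 = 1"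
    "(2::F3) \<noteq> 0" "(2::F3) \<noteq> 1"
  by simp_all

lemma F2_field: "\<exists>y. x * y = 1" if "x \<noteq> 0" for x :: F2
  using F2_cases[of x] that by auto

lemma F3_field: "\<exists>y. x * y = 1" if "x \<noteq> 0" for x :: F3
  using F3_cases[of x] that F3_arith(2) by (metis mult_1)

lemma module_vec: "module ((*s) :: 'a::comm_ring_1 \<Rightarrow> 'a ^ 'n \<Rightarrow> 'a ^ 'n)"
  by unfold_locales (simp_all add: vec_eq_iff algebra_simps)

definition linear_code :: "('a::comm_ring_1 ^ 'n) set \<Rightarrow> bool" where
  "linear_code C \<longleftrightarrow> module.subspace (*s) C"

section \<open>The ring of order six\<close>

text \<open>
  \<open>H23 x y\<close> is the element \<open>ax + by\<close>. The class \<open>comm_ring\<close> does not require a unit.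
  The defining relations and the list of elements are derived below.
\<close>

datatype h23 = H23 (bin: F2) (ter: F3)

instantiation h23 :: comm_ring
begin

definition zero_h23 :: h23 where "0 = H23 0 0"
definition plus_h23 :: "h23 \<Rightarrow> h23 \<Rightarrow> h23" where
  "r + s = H23 (bin r + bin s) (ter r + ter s)"
definition uminus_h23 :: "h23 \<Rightarrow> h23" where "- r = H23 (- bin r) (- ter r)"
definition minus_h23 :: "h23 \<Rightarrow> h23 \<Rightarrow> h23" where
  "r - s = H23 (bin r - bin s) (ter r - ter s)"
definition times_h23 :: "h23 \<Rightarrow> h23 \<Rightarrow> h23" where "r * s = H23 (bin r * bin s) 0"

instance
  by standard
    (simp_all add: zero_h23_def plus_h23_def uminus_h23_def minus_h23_def times_h23_def
      algebra_simps)

end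

definition h23_a :: h23 where "h23_a = H23 1 0"
definition h23_b :: h23 where "h23_b = H23 0 1"

lemma h23_relations:
  "h23_a + h23_a = 0" "h23_b + h23_b + h23_b = 0"
  "h23_a * h23_a = h23_a" "h23_b * h23_b = 0" "h23_a * h23_b = 0" "h23_b * h23_a = 0"
  by (simp_all add: h23_a_def h23_b_def zero_h23_def plus_h23_def times_h23_def)

lemma h23_UNIV:
  "UNIV = {0, h23_a, h23_b, h23_a + h23_b, h23_b + h23_b, h23_a + (h23_b + h23_b)}"
proof -
  have "r \<in> {0, h23_a, h23_b, h23_a + h23_b, h23_b + h23_b, h23_a + (h23_b + h23_b)}" for r
    using F2_cases[of "bin r"] F3_cases[of "ter r"]
    by (cases r) (auto simp: h23_a_def h23_b_def zero_h23_def plus_h23_def)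
  then show ?thesis by blast
qed

instance h23 :: finite
  by standard (simp add: h23_UNIV)

lemma h23_card: "CARD(h23) = 6"
  by (simp add: h23_UNIV h23_a_def h23_b_def zero_h23_def plus_h23_def)

definition a_scale :: "F2 \<Rightarrow> h23" where
  "a_scale x = (if x = 0 then 0 else h23_a)"

definition b_scale :: "F3 \<Rightarrow> h23" where
  "b_scale y = (if y = 0 then 0 else if y = 1 then h23_b else h23_b + h23_b)"

definition a_vec :: "F2 ^ 'n \<Rightarrow> h23 ^ 'n" where "a_vec x = (\<chi> i. a_scale (x $ i))"
definition b_vec :: "F3 ^ 'n \<Rightarrow> h23 ^ 'n" where "b_vec y = (\<chi> i. b_scale (y $ i))"

definition bin_part :: "h23 ^ 'n \<Rightarrow> F2 ^ 'n" where "bin_part c = (\<chi> i. bin (c $ i))"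
definition ter_part :: "h23 ^ 'n \<Rightarrow> F3 ^ 'n" where "ter_part c = (\<chi> i. ter (c $ i))"

lemma a_scale_eq: "a_scale x = H23 x 0"
  using F2_cases[of x] by (auto simp: a_scale_def h23_a_def zero_h23_def)

lemma b_scale_eq: "b_scale y = H23 0 y"
  using F3_cases[of y] by (auto simp: b_scale_def h23_b_def zero_h23_def plus_h23_def)

lemma h23_vec_decomp:
  "c = a_vec x + b_vec y \<longleftrightarrow> x = bin_part c \<and> y = ter_part c"
  by (auto simp: vec_eq_iff a_vec_def b_vec_def bin_part_def ter_part_def a_scale_eq
      b_scale_eq plus_h23_def h23.expand)

section \<open>Codes over the ring\<close>

definition h23_code :: "(h23 ^ 'n) set \<Rightarrow> bool" where
  "h23_code C \<longleftrightarrow> 0 \<in> C \<and> (\<forall>x\<in>C. \<forall>y\<in>C. x + y \<in> C) \<and> (\<forall>x\<in>C. - x \<in> C)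
     \<and> (\<forall>r. \<forall>x\<in>C. r *s x \<in> C)"

definition bin_comp :: "(h23 ^ 'n) set \<Rightarrow> (F2 ^ 'n) set" where
  "bin_comp C = {u. a_vec u \<in> C}"

definition ter_comp :: "(h23 ^ 'n) set \<Rightarrow> (F3 ^ 'n) set" where
  "ter_comp C = {v. b_vec v \<in> C}"

definition h23_sum :: "(F2 ^ 'n) set \<Rightarrow> (F3 ^ 'n) set \<Rightarrow> (h23 ^ 'n) set" where
  "h23_sum C1 C2 = {a_vec u + b_vec v | u v. u \<in> C1 \<and> v \<in> C2}"

section \<open>Symplectic forms and duals\<close>

text \<open>
  A vector of length \<open>2m\<close> is indexed by \<open>'m + 'm\<close> with \<open>m = CARD('m)\<close>: the two summands
  index the halves of \<open>(x\<^sub>1 | x\<^sub>2)\<close>.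
\<close>

definition fst_half :: "'a ^ ('m::finite + 'm) \<Rightarrow> 'a ^ 'm" where "fst_half x = (\<chi> i. x $ Inl i)"
definition snd_half :: "'a ^ ('m::finite + 'm) \<Rightarrow> 'a ^ 'm" where "snd_half x = (\<chi> i. x $ Inr i)"

definition dot :: "'a::comm_semiring_0 ^ 'm \<Rightarrow> 'a ^ 'm \<Rightarrow> 'a" where
  "dot x y = (\<Sum>i\<in>UNIV. x $ i * y $ i)"

definition symp_F2 :: "F2 ^ ('m::finite + 'm) \<Rightarrow> F2 ^ ('m::finite + 'm) \<Rightarrow> F2" where
  "symp_F2 x y = dot (fst_half x) (snd_half y) + dot (snd_half x) (fst_half y)"

definition symp_H23 :: "h23 ^ ('m::finite + 'm) \<Rightarrow> h23 ^ ('m::finite + 'm) \<Rightarrow> h23" where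
  "symp_H23 c d = a_scale (symp_F2 (bin_part c) (bin_part d))"

definition symp_dual_F2 :: "(F2 ^ ('m::finite + 'm)) set \<Rightarrow> (F2 ^ ('m::finite + 'm)) set" where
  "symp_dual_F2 C = {x. \<forall>y\<in>C. symp_F2 x y = 0}"

definition symp_dual_H23 :: "(h23 ^ ('m::finite + 'm)) set \<Rightarrow> (h23 ^ ('m::finite + 'm)) set" where
  "symp_dual_H23 C = {c. \<forall>d\<in>C. symp_H23 c d = 0}"

definition symp_self_orth_F2 :: "(F2 ^ ('m::finite + 'm)) set \<Rightarrow> bool" where
  "symp_self_orth_F2 C \<longleftrightarrow> C \<subseteq> symp_dual_F2 C"

definition symp_self_orth_H23 :: "(h23 ^ ('m::finite + 'm)) set \<Rightarrow> bool" where
  "symp_self_orth_H23 C \<longleftrightarrow> C \<subseteq> symp_dual_H23 C"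

definition symp_QSD :: "(h23 ^ ('m::finite + 'm)) set \<Rightarrow> bool" where
  "symp_QSD C \<longleftrightarrow> h23_code C \<and> symp_self_orth_H23 C \<and> card C = 6 ^ CARD('m)"

end

theory Submission
  imports Defs
begin

text \<open>Sending \<open>c\<close> to \<open>(bin_part c, ter_part c)\<close> is an additive
  bijection that identifies \<open>h23_sum C1 C2\<close> with \<open>C1 \<times> C2\<close>
  (\<open>mem_h23_sum_iff\<close>), so each claim splits into a binary and a ternary one. A ring
  scalar acts on the binary part through \<open>bin r\<close> and kills the ternary part, and the
  form sees binary parts only, so self-orthogonality passes from \<open>C1\<close> to the sum. The
  size is a product (\<open>card_h23_sum\<close>).\<close>

lemma linear_code_closed:
  assumes "linear_code C"
  shows "0 \<in> C" "x \<in> C \<Longrightarrow> y \<in> C \<Longrightarrow> x + y \<in> C" "x \<in> C \<Longrightarrow> - x \<in> C" "x \<in> C \<Longrightarrow> k *s x \<in> C"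
  using assms module.subspace_0[OF module_vec] module.subspace_add[OF module_vec]
    module.subspace_neg[OF module_vec] module.subspace_scale[OF module_vec]
  unfolding linear_code_def by blast+

lemma bin_part_simps [simp]:
  "bin_part 0 = 0" "bin_part (c + d) = bin_part c + bin_part d" "bin_part (- c) = - bin_part c"
  "bin_part (r *s c) = bin r *s bin_part c" "bin_part (a_vec u) = u" "bin_part (b_vec v) = 0"
  by (simp_all add: vec_eq_iff bin_part_def a_vec_def b_vec_def a_scale_eq b_scale_eq
      zero_h23_def plus_h23_def uminus_h23_def times_h23_def)

text \<open>Scaling gives ternary part 0 because \<open>b\<close> annihilates both \<open>a\<close>
  and \<open>b\<close>.\<close>

lemma ter_part_simps [simp]:
  "ter_part 0 = 0" "ter_part (c + d) = ter_part c + ter_part d" "ter_part (- c) = - ter_part c"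
  "ter_part (r *s c) = 0" "ter_part (a_vec u) = 0" "ter_part (b_vec v) = v"
  by (simp_all add: vec_eq_iff ter_part_def a_vec_def b_vec_def a_scale_eq b_scale_eq
      zero_h23_def plus_h23_def uminus_h23_def times_h23_def)

text \<open>Uniqueness of the decomposition removes the existential over \<open>u\<close> and
  \<open>v\<close>.\<close>

lemma mem_h23_sum_iff: "c \<in> h23_sum C1 C2 \<longleftrightarrow> bin_part c \<in> C1 \<and> ter_part c \<in> C2"
  by (auto simp: h23_sum_def h23_vec_decomp)

lemma h23_code_h23_sum:
  assumes "linear_code C1" and "linear_code C2"
  shows "h23_code (h23_sum C1 C2)"
  using linear_code_closed[OF assms(1)] linear_code_closed[OF assms(2)]
  by (simp add: h23_code_def mem_h23_sum_iff)

lemma symp_self_orth_h23_sum: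
  assumes "symp_self_orth_F2 C1"
  shows "symp_self_orth_H23 (h23_sum C1 C2)"
  using assms
  by (auto simp: symp_self_orth_H23_def symp_self_orth_F2_def symp_dual_H23_def symp_dual_F2_def
      symp_H23_def a_scale_def mem_h23_sum_iff)

text \<open>The ternary part of \<open>a_vec u\<close> is 0, which must lie in
  \<open>C2\<close>.\<close>

lemma bin_comp_h23_sum: "0 \<in> C2 \<Longrightarrow> bin_comp (h23_sum C1 C2) = C1"
  by (simp add: bin_comp_def mem_h23_sum_iff)

lemma ter_comp_h23_sum: "0 \<in> C1 \<Longrightarrow> ter_comp (h23_sum C1 C2) = C2"
  by (simp add: ter_comp_def mem_h23_sum_iff)

lemma card_h23_sum: "card (h23_sum C1 C2) = card C1 * card C2"
proof -
  have "bij_betw (\<lambda>(u, v). a_vec u + b_vec v) (C1 \<times> C2) (h23_sum C1 C2)"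
    \<comment> \<open>The inverse splits a vector into its parts; \<open>h23_vec_decomp\<close>
      shows that recombining them returns the vector.\<close>
    by (rule bij_betw_byWitness[where f' = "\<lambda>c. (bin_part c, ter_part c)"])
      (auto simp: mem_h23_sum_iff intro: h23_vec_decomp[THEN iffD2, symmetric])
  then show ?thesis
    by (metis bij_betw_same_card card_cartesian_product)
qed

theorem theorem4p6:
  fixes C1 :: "(F2 ^ ('m::finite + 'm)) set"
    and C2 :: "(F3 ^ ('m + 'm)) set"
    and C :: "(h23 ^ ('m + 'm)) set"
  assumes "linear_code C1" and "linear_code C2"
    and "C = h23_sum C1 C2"
    and "symp_self_orth_F2 C1"
  shows "h23_code C \<and> symp_self_orth_H23 C \<and> bin_comp C = C1 \<and> ter_comp C = C2
    \<and> (card C1 * card C2 = 6 ^ CARD('m) \<longrightarrow> symp_QSD C)"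
  \<comment> \<open>Linearity puts 0 in both codes, as the component lemmas require.\<close>
  using assms linear_code_closed(1)[OF assms(1)] linear_code_closed(1)[OF assms(2)]
  by (simp add: symp_QSD_def h23_code_h23_sum symp_self_orth_h23_sum bin_comp_h23_sum
      ter_comp_h23_sum card_h23_sum)

end
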